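(* Let $\Phi:\mathcal{A}^{\mathbb{L}}\to\mathcal{A}^{\mathbb{L}}$ be a cellular automaton. (a) $\Phi(\mathcal{QS}_\varsigma)\subseteq\mathcal{QS}_\varsigma$; that is, if $\mathbf p\in\mathcal{A}^{\mathbb{L}}$ is a $\varsigma$-quasisturmian sequence, then $\Phi(\mathbf p)$ is also a $\varsigma$-quasisturmian sequence. (b) If $\mathfrak{P}\subset\mathcal{A}^{\mathbb{L}}$ is a $\varsigma$-quasisturmian shift, then $\Phi(\mathfrak{P})$ is also a $\varsigma$-quasisturmian shift. (c) If $\mu$ is a $\varsigma$-quasisturmian measure on $\mathcal{A}^{\mathbb{L}}$, then the push-forward $\Phi(\mu)$ is also a $\varsigma$-quasisturmian measure.
   Context: Fix integers $D,K\ge1$, $\mathbb{L}=\mathbb{Z}^D$, $\mathbf{T}=(\mathbb{R}/\mathbb{Z})^K$ with its usual metric $d$ and Lebesgue (Haar) probability measure $\lambda$, and an injective group homomorphism $\tau:\mathbb{L}\to\mathbf{T}$ with dense image. For $\ell\in\mathbb{L}$ let $\varsigma^\ell(t)=t+\tau(\ell)$ for $t\in\mathbf{T}$. Let $\mathcal{A}$ be a finite set; $\mathcal{A}^{\mathbb{L}}$ carries the product topology. A cellular automaton (CA) is a map $\Phi:\mathcal{A}^{\mathbb{L}}\to\mathcal{A}^{\mathbb{L}}$ for which there are a finite $B\subset\mathbb{L}$ and $\phi:\mathcal{A}^B\to\mathcal{A}$ with $\Phi(\mathbf a)_\ell=\phi([a_{\ell+b}]_{b\in B})$ for all $\mathbf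 a\in\mathcal{A}^{\mathbb{L}}$, $\ell\in\mathbb{L}$. A measurable partition is a family $\mathcal P=\{P_a\}_{a\in\mathcal A}$ of disjoint measurable subsets of $\mathbf{T}$ such that $P_*:=\bigsqcup_a P_a$ has $\lambda(P_* )=1$. It is an open partition if moreover all $P_a$ are open and $P_*$ is dense. Let $\widetilde{\mathbf T}(\mathcal P)=\bigcap_{\ell\in\mathbb{L}}\varsigma^\ell(P_* )$ (it has $\lambda$-measure $1$), and for $t\in\widetilde{\mathbf T}(\mathcal P)$ define $\mathcal P_\varsigma(t)\in\mathcal A^{\mathbb L}$ by: $\mathcal P_\varsigma(t)_\ell$ is the unique $a$ with $\varsigma^\ell(t)\in P_a$. A $\varsigma$-quasisturmian sequence is an element of $\mathcal{QS}_\varsigma:=\{\mathcal P_\varsigma(t): \mathcal P \text{ an open partition},\ t\in\widetilde{\mathbf T}(\mathcal P)\}$. A $\varsigma$-quasisturmian shift is a set of the form $\Xi_\varsigma(\mathcal P):=$ closure of $\mathcal P_\varsigma(\widetilde{\mathbf T}(\mathcal P))$ in the product topology, with $\mathcal P$ an open partition. A $\varsigma$-quasisturmian measure is a measure of the form $\Upsilon_\varsigma(\mathcal P):=\mathcal P_\varsigma(\lambda)$ (push-forward of $\lambda$), with $\mathcal P$ a measurable partition. *)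

theory Defs
  imports "HOL-Probability.Probability"
begin

section \<open>The circle group \<open>\<real>/\<int>\<close> and the torus\<close>

quotient_type circle = real / "\<lambda>x y. x - y \<in> \<int>"
  morphisms rep_circle to_circle
proof (rule equivpI)
  show "reflp (\<lambda>x y. x - y \<in> (\<int> :: real set))"
    by (rule reflpI) simp
  show "symp (\<lambda>x y. x - y \<in> (\<int> :: real set))"
    by (rule sympI) (metis Ints_minus minus_diff_eq)
  show "transp (\<lambda>x y. x - y \<in> (\<int> :: real set))"
  proof (rule transpI)
    fix x y z :: real
    assume "x - y \<in> \<int>" "y - z \<in> \<int>"
    then have "(x - y) + (y - z) \<in> \<int>" by (rule Ints_add)
    then show "x - z \<in> \<int>" by simp
  qed
qed

instantiation circle :: ab_group_add
begin

lift_definition zero_circle :: circle is "0 :: real" .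

lift_definition plus_circle :: "circle \<Rightarrow> circle \<Rightarrow> circle" is "(+) :: real \<Rightarrow> real \<Rightarrow> real"
  by (metis Ints_add add_diff_add)

lift_definition uminus_circle :: "circle \<Rightarrow> circle" is "uminus :: real \<Rightarrow> real"
  by (metis Ints_minus minus_diff_minus)

lift_definition minus_circle :: "circle \<Rightarrow> circle \<Rightarrow> circle" is "(-) :: real \<Rightarrow> real \<Rightarrow> real"
  by (metis Ints_diff diff_diff_eq2 diff_diff_eq add_diff_eq diff_add_eq add.commute)

instance
  by standard (transfer, simp)+

end

lemma infdist_Ints_shift:
  fixes x y :: real
  assumes "x - y \<in> \<int>"
  shows "infdist x \<int> = infdist y \<int>"
proof -
  have le: "infdist u \<int> \<le> infdist v \<int>" if "u - v \<in> \<int>" for u v :: real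
  proof -
    have "infdist u \<int> \<le> dist v n" if n: "n \<in> \<int>" for n :: real
    proof -
      have "n + (u - v) \<in> \<int>" using n \<open>u - v \<in> \<int>\<close> by simp
      then have "infdist u \<int> \<le> dist u (n + (u - v))" by (rule infdist_le)
      then show ?thesis by (simp add: dist_real_def)
    qed
    then show ?thesis
      by (subst (2) infdist_notempty) (auto intro!: cINF_greatest)
  qed
  have "y - x \<in> \<int>" using assms by (metis Ints_minus minus_diff_eq)
  then show ?thesis using le[OF assms] le[of y x] by simp
qed

lemma infdist_Ints_attained:
  fixes x :: real
  obtains n where "n \<in> \<int>" "infdist x \<int> = dist x n"
  using infdist_attains_inf[OF closed_Ints, of x] Ints_0 by blast

lemma infdist_Ints_add:
  fixes x y :: real
  shows "infdist (x + y) \<int> \<le> infdist x \<int> + infdist y \<int>"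
proof -
  obtain m where m: "m \<in> (\<int> :: real set)" "infdist x \<int> = dist x m"
    by (rule infdist_Ints_attained)
  obtain n where n: "n \<in> (\<int> :: real set)" "infdist y \<int> = dist y n"
    by (rule infdist_Ints_attained)
  have "infdist (x + y) \<int> \<le> dist (x + y) (m + n)"
    using m(1) n(1) by (intro infdist_le) simp
  also have "\<dots> \<le> dist x m + dist y n" by (simp add: dist_real_def)
  finally show ?thesis using m n by simp
qed

text \<open>
  The metric is the quotient metric: the distance of two classes is the distance of
  \<open>x - y\<close> to the nearest integer. The metric, topology and group structure of the torus
  \<open>(circle, 'k) vec\<close> are then the ones the library puts on finite Cartesian powers.
\<close>

instantiation circle :: metric_space
begin

lift_definition dist_circle :: "circle \<Rightarrow> circle \<Rightarrow> real" is "\<lambda>x y. infdist (x - y) \<int>"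
proof -
  fix x x' y y' :: real
  assume "x - x' \<in> \<int>" "y - y' \<in> \<int>"
  then have "(x - x') - (y - y') \<in> \<int>" by (rule Ints_diff)
  then show "infdist (x - y) \<int> = infdist (x' - y') \<int>"
    by (intro infdist_Ints_shift) (simp add: algebra_simps)
qed

definition uniformity_circle :: "(circle \<times> circle) filter" where
  "uniformity_circle = (INF e\<in>{0 <..}. principal {(x, y). dist x y < e})"

definition open_circle :: "circle set \<Rightarrow> bool" where
  "open_circle U \<longleftrightarrow> (\<forall>x\<in>U. eventually (\<lambda>(x', y). x' = x \<longrightarrow> y \<in> U) uniformity)"

instance
proof
  fix x y z :: circle
  show "dist x y = 0 \<longleftrightarrow> x = y"
    by transfer (metis Ints_0 closed_Ints empty_iff in_closed_iff_infdist_zero)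
  show "dist x y \<le> dist x z + dist y z"
  proof transfer
    fix x y z :: real
    have neg: "infdist (z - y) \<int> \<le> infdist (y - z) \<int>"
    proof -
      obtain n where n: "n \<in> (\<int> :: real set)" "infdist (y - z) \<int> = dist (y - z) n"
        by (rule infdist_Ints_attained)
      have "infdist (z - y) \<int> \<le> dist (z - y) (- n)"
        using n(1) by (intro infdist_le) simp
      then show ?thesis using n(2) by (simp add: dist_real_def)
    qed
    show "infdist (x - y) \<int> \<le> infdist (x - z) \<int> + infdist (y - z) \<int>"
      using infdist_Ints_add[of "x - z" "z - y"] neg by simp
  qed
qed (fact uniformity_circle_def open_circle_def)+

end

lemma open_circle_iff: "open U \<longleftrightarrow> open (to_circle -` U)"
proof
  have d: "dist (to_circle x) (to_circle y) \<le> dist x y" for x y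
    by transfer (metis Ints_0 dist_0_norm dist_commute dist_norm infdist_le)
  have "continuous_on UNIV to_circle"
    unfolding continuous_on_iff using d by (meson UNIV_I le_less_trans)
  then show "open U \<Longrightarrow> open (to_circle -` U)" by (simp add: open_vimage)
next
  assume *: "open (to_circle -` U)"
  show "open U"
    unfolding open_dist
  proof
    fix c assume "c \<in> U"
    obtain x where x: "c = to_circle x" by (metis Quotient3_abs_rep Quotient3_circle)
    with \<open>c \<in> U\<close> * obtain e where e: "e > 0" "\<And>y. dist y x < e \<Longrightarrow> to_circle y \<in> U"
      unfolding open_dist by auto
    have "c' \<in> U" if c': "dist c' c < e" for c'
    proof -
      obtain y where y: "c' = to_circle y" by (metis Quotient3_abs_rep Quotient3_circle)
      obtain n where n: "n \<in> (\<int> :: real set)" "infdist (y - x) \<int> = dist (y - x) n"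
        by (rule infdist_Ints_attained)
      have "dist (y - n) x = dist (to_circle y) (to_circle x)"
        using n(2) by (simp add: dist_circle.abs_eq dist_real_def algebra_simps)
      then have "to_circle (y - n) \<in> U" using e c' x y by simp
      moreover have "to_circle (y - n) = to_circle y"
        using n(1) by (simp add: circle.abs_eq_iff)
      ultimately show ?thesis using y by simp
    qed
    then show "\<exists>e>0. \<forall>y. dist y c < e \<longrightarrow> y \<in> U" using e(1) by blast
  qed
qed

definition to_torus :: "real ^ 'k \<Rightarrow> circle ^ 'k" where
  "to_torus x = (\<chi> i. to_circle (x $ i))"

text \<open>
  Lebesgue (Haar) probability measure on the torus: Lebesgue measure of the unit cube, a
  fundamental domain up to null sets, carried to the torus by the quotient map. The
  completion makes ``measurable'' mean Lebesgue measurable.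
\<close>

definition torus_measure :: "(circle ^ 'k) measure" where
  "torus_measure = completion (distr (uniform_measure lborel (cbox 0 1)) borel to_torus)"

lemma continuous_to_torus: "continuous_on UNIV to_torus"
  unfolding to_torus_def
proof (intro continuous_on_vec_lambda)
  fix i :: "'k::finite"
  have "continuous_on UNIV to_circle"
    by (simp add: continuous_on_open_vimage open_circle_iff[symmetric])
  then show "continuous_on UNIV (\<lambda>x :: real ^ 'k. to_circle (x $ i))"
    by (rule continuous_on_compose2) (auto intro!: continuous_intros)
qed

lemma measurable_to_torus [measurable]: "to_torus \<in> borel_measurable borel"
  by (rule borel_measurable_continuous_onI[OF continuous_to_torus])

lemma emeasure_unit_cube: "emeasure lborel (cbox 0 (1 :: real ^ 'k)) = 1"
proof -
  have "(1 :: real ^ 'k) \<bullet> b = 1" if "b \<in> Basis" for b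
    using that by (auto simp: Basis_vec_def inner_axis)
  then show ?thesis by (simp add: emeasure_lborel_cbox_eq)
qed

lemma prob_space_torus_measure: "prob_space (torus_measure :: (circle ^ 'k) measure)"
proof -
  have "prob_space (uniform_measure lborel (cbox 0 (1 :: real ^ 'k)))"
    by (rule prob_space_uniform_measure) (simp_all add: emeasure_unit_cube)
  then have "prob_space (distr (uniform_measure lborel (cbox 0 (1 :: real ^ 'k))) borel to_torus)"
    by (rule prob_space.prob_space_distr) (simp cong: measurable_cong_sets)
  then show ?thesis
    unfolding torus_measure_def by (rule prob_space.prob_space_completion)
qed


section \<open>Configurations and cellular automata\<close>

definition config_topology :: "(int ^ 'd \<Rightarrow> 'a) topology" where
  "config_topology = product_topology (\<lambda>_. discrete_topology UNIV) UNIV"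

definition config_borel :: "(int ^ 'd \<Rightarrow> 'a) measure" where
  "config_borel = sigma UNIV {U. openin config_topology U}"

text \<open>
  The local rule is only ever applied to neighbourhood patterns: functions that are
  \<^const>\<open>undefined\<close> outside the neighbourhood \<open>B\<close>.
\<close>

definition cellular_automaton :: "((int ^ 'd \<Rightarrow> 'a) \<Rightarrow> (int ^ 'd \<Rightarrow> 'a)) \<Rightarrow> bool" where
  "cellular_automaton \<Phi> \<longleftrightarrow>
     (\<exists>B (\<phi> :: (int ^ 'd \<Rightarrow> 'a) \<Rightarrow> 'a). finite B \<and>
        (\<forall>a l. \<Phi> a l = \<phi> (\<lambda>b\<in>B. a (l + b))))"


section \<open>Partitions of the torus and quasisturmian objects\<close>

definition rotation :: "(int ^ 'd \<Rightarrow> circle ^ 'k) \<Rightarrow> int ^ 'd \<Rightarrow> circle ^ 'k \<Rightarrow> circle ^ 'k" where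
  "rotation \<tau> l t = t + \<tau> l"

definition measurable_partition :: "('a \<Rightarrow> (circle ^ 'k) set) \<Rightarrow> bool" where
  "measurable_partition P \<longleftrightarrow>
     (\<forall>a. P a \<in> sets torus_measure) \<and> disjoint_family P \<and>
     emeasure torus_measure (\<Union>a. P a) = 1"

definition open_partition :: "('a \<Rightarrow> (circle ^ 'k) set) \<Rightarrow> bool" where
  "open_partition P \<longleftrightarrow>
     measurable_partition P \<and> (\<forall>a. open (P a)) \<and> closure (\<Union>a. P a) = UNIV"

definition coding_domain ::
    "(int ^ 'd \<Rightarrow> circle ^ 'k) \<Rightarrow> ('a \<Rightarrow> (circle ^ 'k) set) \<Rightarrow> (circle ^ 'k) set" where
  "coding_domain \<tau> P = (\<Inter>l. rotation \<tau> l ` (\<Union>a. P a))"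

text \<open>Only meaningful for \<open>t \<in> coding_domain \<tau> P\<close>.\<close>

definition coding ::
    "(int ^ 'd \<Rightarrow> circle ^ 'k) \<Rightarrow> ('a \<Rightarrow> (circle ^ 'k) set) \<Rightarrow> circle ^ 'k \<Rightarrow> (int ^ 'd \<Rightarrow> 'a)" where
  "coding \<tau> P t l = (THE a. rotation \<tau> l t \<in> P a)"

definition quasisturmian_sequences :: "(int ^ 'd \<Rightarrow> circle ^ 'k) \<Rightarrow> (int ^ 'd \<Rightarrow> 'a) set" where
  "quasisturmian_sequences \<tau> =
     {coding \<tau> P t | P t. open_partition P \<and> t \<in> coding_domain \<tau> P}"

definition quasisturmian_shift ::
    "(int ^ 'd \<Rightarrow> circle ^ 'k) \<Rightarrow> (int ^ 'd \<Rightarrow> 'a) set \<Rightarrow> bool" where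
  "quasisturmian_shift \<tau> X \<longleftrightarrow>
     (\<exists>P. open_partition P \<and> X = config_topology closure_of (coding \<tau> P ` coding_domain \<tau> P))"

text \<open>
  The coding is defined only on the coding domain, a set of full measure, so the push-forward
  is taken from the restriction to that set.
\<close>

definition quasisturmian_measure ::
    "(int ^ 'd \<Rightarrow> circle ^ 'k) \<Rightarrow> (int ^ 'd \<Rightarrow> 'a) measure \<Rightarrow> bool" where
  "quasisturmian_measure \<tau> \<mu> \<longleftrightarrow>
     (\<exists>P. measurable_partition P \<and>
        \<mu> = distr (restrict_space torus_measure (coding_domain \<tau> P)) config_borel (coding \<tau> P))"

end

theory Submission
  imports Defs
begin

text \<open>
  A cellular automaton acts on codings by refining the partition. Let \<open>\<Phi>\<close> have neighbourhood \<open>B\<close>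
  and local rule \<open>\<phi>\<close>. The symbol of \<open>\<Phi>\<close> applied to the \<open>P\<close>-coding of \<open>t\<close> at the site \<open>l\<close> depends
  only on the atoms of \<open>P\<close> that contain the finitely many points \<open>t + \<tau> l + \<tau> b\<close>, \<open>b \<in> B\<close>, hence only
  on the point \<open>t + \<tau> l\<close>, and in the same way for every \<open>l\<close>. So there is one partition \<open>Q\<close>,
  \<open>induced_partition\<close> below, whose atom \<open>Q c\<close> consists of the points where the local rule reads \<open>c\<close>,
  and \<open>\<Phi>\<close> carries the \<open>P\<close>-coding of \<open>t\<close> to its \<open>Q\<close>-coding (\<open>coding_induced\<close>).

  Each \<open>Q c\<close> is a finite union of finite intersections of translated atoms of \<open>P\<close>, and the union of
  all \<open>Q c\<close> is a finite intersection of translates of the union of \<open>P\<close>. Openness, density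
  and full measure therefore pass from \<open>P\<close> to \<open>Q\<close>; for the last two one needs that finitely many
  open dense sets have dense intersection, and that the measure on the torus is translation invariant.
  When \<open>0 \<in> B\<close>, which can always be arranged, \<open>P\<close> and \<open>Q\<close> also have the same coding domain.

  All three claims are then read off from the identity of codings. For sequences nothing more is
  needed. For shifts, \<open>\<Phi>\<close> commutes with closure because it is continuous on a compact Hausdorff
  space (\<open>block_map_image_closure_of\<close>). For measures, pushing forward in two steps is pushing forward
  along the composite, since codings and cellular automata are measurable (\<open>measurable_coding\<close>,
  \<open>measurable_block_map\<close>).
\<close>

section \<open>Translation invariance of the measure on the torus\<close>

lemma emeasure_lborel_translate:
  fixes c :: "'a::euclidean_space"
  assumes [measurable]: "S \<in> sets borel"
  shows "emeasure lborel {x. x + c \<in> S} = emeasure lborel S"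
proof -
  have "emeasure lborel S = emeasure (distr lborel borel ((+) c)) S"
    by (simp add: lborel_distr_plus)
  also have "\<dots> = emeasure lborel {x. x + c \<in> S}"
    by (subst emeasure_distr) (auto simp: vimage_def add.commute)
  finally show ?thesis by simp
qed

definition vec_of_int :: "int ^ 'k \<Rightarrow> real ^ 'k" where
  "vec_of_int n = (\<chi> i. of_int (n $ i))"

definition vec_floor :: "real ^ 'k \<Rightarrow> int ^ 'k" where
  "vec_floor x = (\<chi> i. \<lfloor>x $ i\<rfloor>)"

lemma vec_floor_add_vec_of_int: "vec_floor (x + vec_of_int n) = vec_floor x + n"
  by (simp add: vec_eq_iff vec_floor_def vec_of_int_def)

lemma vec_floor_diff_borel:
  fixes y :: "real ^ 'k"
  shows "{x. vec_floor (x - y) = n} \<in> sets borel"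
proof -
  have [measurable]: "(\<lambda>x :: real ^ 'k. x $ i) \<in> borel_measurable borel" for i
    by (intro borel_measurable_continuous_onI continuous_intros)
  have "{x \<in> space borel. \<forall>i. \<lfloor>x $ i - y $ i\<rfloor> = n $ i} \<in> sets borel"
    by measurable
  then show ?thesis by (simp add: vec_eq_iff vec_floor_def)
qed

text \<open>
  The half-open unit cube \<open>vec_floor x = 0\<close> and its translate by \<open>y\<close> are both fundamental domains for
  the integer lattice, so a periodic set has the same volume in each: cut the translated
  cube into its pieces in the lattice cells, move each piece back into the unit cube, and observe that the
  pieces tile it.
\<close>

lemma emeasure_periodic_fundamental_domain:
  fixes A :: "(real ^ 'k) set"
  assumes A: "A \<in> sets borel" and per: "\<And>x n. x + vec_of_int n \<in> A \<longleftrightarrow> x \<in> A"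
  shows "emeasure lborel (A \<inter> {x. vec_floor (x - y) = 0}) = emeasure lborel (A \<inter> {x. vec_floor x = 0})"
proof -
  have fl [measurable]: "{x :: real ^ 'k. vec_floor x = n} \<in> sets borel" for n
    using vec_floor_diff_borel[of 0] by simp
  note [measurable] = A vec_floor_diff_borel
  let ?S = "\<lambda>m n. A \<inter> {x. vec_floor (x - y) = m} \<inter> {x. vec_floor x = n}"
  have S [measurable]: "?S m n \<in> sets lborel" for m n by simp
  have "emeasure lborel (A \<inter> {x. vec_floor (x - y) = 0}) = emeasure lborel (\<Union>n. ?S 0 n)"
    by (rule arg_cong[where f = "emeasure lborel"]) auto
  also have "\<dots> = (\<integral>\<^sup>+n. emeasure lborel (?S 0 n) \<partial>count_space UNIV)"
    by (rule emeasure_UN_countable) (use S in \<open>auto simp: disjoint_family_on_def\<close>)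
  also have "\<dots> = (\<integral>\<^sup>+n. emeasure lborel (?S (- n) 0) \<partial>count_space UNIV)"
  proof (rule nn_integral_cong)
    fix n :: "int ^ 'k"
    have "vec_floor (x + vec_of_int n - y) = vec_floor (x - y) + n" for x
      using vec_floor_add_vec_of_int[of "x - y" n] by (simp add: algebra_simps)
    then have "{x. x + vec_of_int n \<in> ?S 0 n} = ?S (- n) 0"
      by (auto simp: per vec_floor_add_vec_of_int eq_neg_iff_add_eq_0)
    moreover have "?S 0 n \<in> sets borel" using S by simp
    ultimately show "emeasure lborel (?S 0 n) = emeasure lborel (?S (- n) 0)"
      using emeasure_lborel_translate[of "?S 0 n" "vec_of_int n"] by simp
  qed
  also have "\<dots> = emeasure lborel (\<Union>n. ?S (- n) 0)"
    by (rule emeasure_UN_countable[symmetric]) (use S in \<open>auto simp: disjoint_family_on_def\<close>)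
  also have "(\<Union>n. ?S (- n) 0) = A \<inter> {x. vec_floor x = 0}"
  proof -
    have "\<exists>n. m = - n" for m :: "int ^ 'k"
      by (rule exI[of _ "- m"]) simp
    then show ?thesis by auto
  qed
  finally show ?thesis .
qed

text \<open>
  The closed cube in the definition of the torus measure and the half-open cube both lie between the
  open and the closed cube, which differ by a null set.
\<close>

lemma emeasure_cube_vec_floor:
  fixes A :: "(real ^ 'k) set"
  assumes A: "A \<in> sets borel"
  shows "emeasure lborel (cbox 0 1 \<inter> A) = emeasure lborel (A \<inter> {x. vec_floor x = 0})"
proof -
  have one: "(1 :: real ^ 'k) \<bullet> b = 1" if "b \<in> Basis" for b
    using that by (auto simp: Basis_vec_def inner_axis)
  then have box: "emeasure lborel (box 0 (1 :: real ^ 'k)) = 1"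
    by (simp add: emeasure_lborel_box_eq)
  have sub: "box 0 (1 :: real ^ 'k) \<subseteq> {x. vec_floor x = 0}"
    "{x. vec_floor x = 0} \<subseteq> cbox 0 (1 :: real ^ 'k)"
    by (auto simp: mem_box_cart vec_eq_iff vec_floor_def floor_eq_iff less_imp_le)
  have "emeasure lborel (cbox 0 (1 :: real ^ 'k) - box 0 1) = 0"
    by (subst emeasure_Diff) (auto simp: box emeasure_unit_cube box_subset_cbox)
  then have "AE x in lborel. x \<notin> cbox 0 (1 :: real ^ 'k) - box 0 1"
    by (intro AE_not_in null_setsI) auto
  then have "AE x in lborel. x \<in> cbox 0 1 \<inter> A \<longleftrightarrow> x \<in> A \<inter> {x. vec_floor x = 0}"
    by eventually_elim (use sub in auto)
  then show ?thesis
    by (rule emeasure_eq_AE) (use A vec_floor_diff_borel[of 0 0] in auto)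
qed

lemma to_torus_surj: "\<exists>x. to_torus x = t"
proof
  show "to_torus (\<chi> i. rep_circle (t $ i)) = t"
    by (simp add: to_torus_def vec_eq_iff Quotient3_abs_rep[OF Quotient3_circle])
qed

lemma to_torus_add: "to_torus (x + y) = to_torus x + to_torus y"
  by (simp add: to_torus_def vec_eq_iff plus_circle.abs_eq)

lemma to_torus_vec_of_int: "to_torus (vec_of_int n) = 0"
  by (simp add: to_torus_def vec_of_int_def vec_eq_iff zero_circle_def circle.abs_eq_iff)

lemma dist_torus_add_right:
  fixes s t u :: "circle ^ 'k"
  shows "dist (s + u) (t + u) = dist s t"
proof -
  have "dist (a + c) (b + c) = dist a b" for a b c :: circle
    by transfer simp
  then show ?thesis by (simp add: dist_vec_def)
qed

lemma continuous_torus_translation: "continuous_on UNIV (\<lambda>t :: circle ^ 'k. t + s)"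
  unfolding continuous_on_iff by (metis dist_torus_add_right)

text \<open>
  The torus measure before completion; invariance is proved on Borel sets first.
\<close>

definition torus_borel_measure :: "(circle ^ 'k) measure" where
  "torus_borel_measure = distr (uniform_measure lborel (cbox 0 1)) borel to_torus"

lemma sets_torus_borel_measure [measurable_cong, simp]: "sets torus_borel_measure = sets borel"
  by (simp add: torus_borel_measure_def)

lemma space_torus_borel_measure [simp]: "space torus_borel_measure = UNIV"
  by (simp add: torus_borel_measure_def)

lemma emeasure_torus_borel_measure:
  assumes [measurable]: "A \<in> sets borel"
  shows "emeasure torus_borel_measure A = emeasure lborel (cbox 0 1 \<inter> to_torus -` A)"
proof -
  have "to_torus \<in> measurable (uniform_measure lborel (cbox 0 1)) borel"
    by (simp cong: measurable_cong_sets)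
  moreover have "to_torus -` A \<in> sets borel"
    using measurable_sets[OF measurable_to_torus assms] by simp
  ultimately show ?thesis
    using assms by (simp add: torus_borel_measure_def emeasure_distr emeasure_unit_cube divide_ennreal_def)
qed

text \<open>
  Lifted to the universal cover, a Borel set becomes a periodic set, and translating it amounts to
  measuring it in a translated fundamental domain.
\<close>

lemma torus_borel_measure_translation:
  "distr torus_borel_measure torus_borel_measure (\<lambda>t. t + s) = torus_borel_measure"
    (is "distr ?M ?M ?f = ?M")
proof (rule measure_eqI)
  show "sets (distr ?M ?M ?f) = sets ?M" by simp
  fix A assume "A \<in> sets (distr ?M ?M ?f)"
  then have A: "A \<in> sets borel" by simp
  have f: "?f \<in> borel_measurable borel"
    by (rule borel_measurable_continuous_onI[OF continuous_torus_translation])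
  obtain y where y: "to_torus y = s" using to_torus_surj by blast
  have fA: "?f -` A \<in> sets borel" using measurable_sets[OF f A] by simp
  let ?A = "to_torus -` A"
  have A': "?A \<in> sets borel" "to_torus -` (?f -` A) \<in> sets borel"
    using measurable_sets[OF measurable_to_torus A] measurable_sets[OF measurable_to_torus fA]
    by simp_all
  have per: "x + vec_of_int n \<in> ?A \<longleftrightarrow> x \<in> ?A" for x n
    by (simp add: to_torus_add to_torus_vec_of_int)
  have "emeasure (distr ?M ?M ?f) A = emeasure ?M (?f -` A)"
    using f A by (subst emeasure_distr) (auto cong: measurable_cong_sets)
  also have "\<dots> = emeasure lborel (to_torus -` (?f -` A) \<inter> {x. vec_floor x = 0})"
    using fA A' by (simp add: emeasure_torus_borel_measure emeasure_cube_vec_floor)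
  also have "to_torus -` (?f -` A) \<inter> {x. vec_floor x = 0}
      = {x. x + y \<in> ?A \<inter> {x. vec_floor (x - y) = 0}}"
    by (auto simp: to_torus_add y)
  also have "emeasure lborel \<dots> = emeasure lborel (?A \<inter> {x. vec_floor (x - y) = 0})"
    using A' vec_floor_diff_borel by (intro emeasure_lborel_translate) auto
  also have "\<dots> = emeasure lborel (?A \<inter> {x. vec_floor x = 0})"
    by (rule emeasure_periodic_fundamental_domain[OF A'(1) per])
  also have "\<dots> = emeasure ?M A"
    using A A' by (simp add: emeasure_torus_borel_measure emeasure_cube_vec_floor)
  finally show "emeasure (distr ?M ?M ?f) A = emeasure ?M A" .
qed

lemma torus_measure_completion: "torus_measure = completion torus_borel_measure"
  by (simp add: torus_measure_def torus_borel_measure_def)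

lemma space_torus_measure [simp]: "space torus_measure = UNIV"
  by (simp add: torus_measure_completion)

text \<open>
  Invariance on Borel sets makes translations preserve Borel null sets, so preimages of Lebesgue
  measurable sets are Lebesgue measurable and invariance extends to the completion.
\<close>

lemma
  shows measurable_torus_translation:
      "(\<lambda>t. t + s) \<in> measurable torus_measure torus_measure" (is ?measurable)
    and torus_measure_translation:
      "distr torus_measure torus_measure (\<lambda>t. t + s) = torus_measure" (is ?invariant)
proof -
  let ?M = "torus_borel_measure :: (circle ^ 'k) measure"
  have f: "(\<lambda>t. t + s) \<in> measurable ?M ?M"
    using borel_measurable_continuous_onI[OF continuous_torus_translation]
    by (auto cong: measurable_cong_sets)
  have d: "distr (completion ?M) ?M (\<lambda>t. t + s) = ?M"
    using distr_completion[OF f] torus_borel_measure_translation by simp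
  show ?measurable
    unfolding torus_measure_completion
    by (rule completion.measurable_completion2) (use f d in \<open>auto intro: measurable_completion\<close>)
  show ?invariant
    unfolding torus_measure_completion
    using completion.completion_distr_eq[OF measurable_completion[OF f]] d by simp
qed

lemma AE_torus_translation:
  assumes "A \<in> sets torus_measure" "emeasure torus_measure A = 1"
  shows "AE t in torus_measure. t + s \<in> A"
proof -
  interpret prob_space torus_measure by (rule prob_space_torus_measure)
  have "AE t in distr torus_measure torus_measure (\<lambda>t. t + s). t \<in> A"
    using assms by (subst torus_measure_translation) (simp add: AE_in_set_eq_1 measure_def)
  then show ?thesis
    using assms(1) by (subst (asm) AE_distr_iff) (auto intro: measurable_torus_translation)
qed

lemma closure_translation_preimage:
  fixes A :: "(circle ^ 'k) set"
  assumes "closure A = UNIV"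
  shows "closure ((\<lambda>t. t + s) -` A) = UNIV"
proof -
  have "\<exists>y\<in>(\<lambda>t. t + s) -` A. dist y t < e" if "e > 0" for t e
  proof -
    have "t + s \<in> closure A" using assms by simp
    then obtain y where "y \<in> A" "dist y (t + s) < e"
      using \<open>e > 0\<close> closure_approachable by blast
    then show ?thesis
      using dist_torus_add_right[of "y - s" s t] by (intro bexI[of _ "y - s"]) auto
  qed
  then show ?thesis by (auto simp: closure_approachable)
qed

text \<open>
  An open dense set meets any dense set in a dense set; iterate finitely often.
\<close>

lemma closure_INT_open_dense:
  assumes "finite B" "\<And>b. b \<in> B \<Longrightarrow> open (U b)" "\<And>b. b \<in> B \<Longrightarrow> closure (U b) = UNIV"
  shows "closure (\<Inter>b\<in>B. U b) = UNIV"
  using assms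
proof (induction B rule: finite_induct)
  case (insert b B)
  then have "U b \<subseteq> closure (U b \<inter> (\<Inter>b\<in>B. U b))"
    using open_Int_closure_subset[of "U b" "\<Inter>b\<in>B. U b"] by simp
  then have "closure (U b) \<subseteq> closure (U b \<inter> (\<Inter>b\<in>B. U b))"
    by (rule closure_minimal) simp
  then show ?case using insert by auto
qed simp

section \<open>The space of configurations\<close>

lemma topspace_config_topology [simp]: "topspace config_topology = UNIV"
  by (simp add: config_topology_def)

definition cylinder :: "('i \<Rightarrow> 'a) \<Rightarrow> 'i set \<Rightarrow> ('i \<Rightarrow> 'a) set" where
  "cylinder x F = {a. \<forall>i\<in>F. a i = x i}"

lemma openin_cylinder:
  assumes "finite F"
  shows "openin config_topology (cylinder x F)"
proof -
  have "cylinder x F = PiE UNIV (\<lambda>i. if i \<in> F then {x i} else UNIV)"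
    unfolding cylinder_def PiE_UNIV_domain Pi_def by simp (metis singletonD singletonI UNIV_I)
  moreover have "finite {i \<in> UNIV. (if i \<in> F then {x i} else UNIV) \<noteq> topspace (discrete_topology UNIV)}"
    using assms by (rule rev_finite_subset) auto
  ultimately show ?thesis
    unfolding config_topology_def by (simp add: openin_PiE_gen)
qed

text \<open>
  Cylinders over finite sets of coordinates are a base: a basic open box restricts only
  finitely many coordinates, and pinning these to the values of a point of the box stays inside it.
\<close>

lemma openin_config_topology_iff:
  "openin config_topology U \<longleftrightarrow> (\<forall>x\<in>U. \<exists>F. finite F \<and> cylinder x F \<subseteq> U)"
proof
  assume U: "openin config_topology U"
  show "\<forall>x\<in>U. \<exists>F. finite F \<and> cylinder x F \<subseteq> U"
  proof
    fix x assume "x \<in> U"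
    then obtain V where V: "finite {i. V i \<noteq> UNIV}" "x \<in> Pi\<^sub>E UNIV V" "Pi\<^sub>E UNIV V \<subseteq> U"
      using bspec[OF U[unfolded config_topology_def openin_product_topology_alt] \<open>x \<in> U\<close>]
      by (elim exE conjE) simp
    have "cylinder x {i. V i \<noteq> UNIV} \<subseteq> Pi\<^sub>E UNIV V"
    proof
      fix a assume a: "a \<in> cylinder x {i. V i \<noteq> UNIV}"
      have "a i \<in> V i" for i
        using a V(2) by (cases "V i = UNIV") (simp_all add: cylinder_def PiE_UNIV_domain Pi_iff)
      then show "a \<in> Pi\<^sub>E UNIV V" by (simp add: PiE_UNIV_domain)
    qed
    also note V(3)
    finally show "\<exists>F. finite F \<and> cylinder x F \<subseteq> U"
      using V(1) by (intro exI conjI)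
  qed
next
  assume *: "\<forall>x\<in>U. \<exists>F. finite F \<and> cylinder x F \<subseteq> U"
  show "openin config_topology U"
  proof (rule iffD2[OF openin_subopen], rule ballI)
    fix x assume "x \<in> U"
    with * obtain F where "finite F" "cylinder x F \<subseteq> U" by blast
    moreover have "x \<in> cylinder x F" by (simp add: cylinder_def)
    ultimately show "\<exists>T. openin config_topology T \<and> x \<in> T \<and> T \<subseteq> U"
      by (intro exI[of _ "cylinder x F"] conjI openin_cylinder)
  qed
qed

lemma countable_cylinders:
  "countable {cylinder (x :: 'i::countable \<Rightarrow> 'a::finite) F | x F. finite F}" (is "countable ?C")
proof -
  let ?I = "SIGMA F : {F :: 'i set. finite F}. F \<rightarrow>\<^sub>E (UNIV :: 'a set)"
  have "countable ?I"
    by (intro countable_SIGMA countable_Collect_finite countable_PiE) auto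
  then have "countable ((\<lambda>(F, x). cylinder x F) ` ?I)" by (rule countable_image)
  moreover have "?C \<subseteq> (\<lambda>(F, x). cylinder x F) ` ?I"
  proof
    fix S assume "S \<in> ?C"
    then obtain x F where "finite F" and S: "S = cylinder x F" by blast
    then have "S = cylinder (restrict x F) F" by (simp add: cylinder_def)
    then show "S \<in> (\<lambda>(F, x). cylinder x F) ` ?I"
      using \<open>finite F\<close> by (intro image_eqI[of _ _ "(F, restrict x F)"]) auto
  qed
  ultimately show ?thesis by (rule countable_subset[rotated])
qed

lemma space_config_borel [simp]: "space config_borel = UNIV"
  by (simp add: config_borel_def space_measure_of_conv)

text \<open>
  Over a countable index set and a finite alphabet there are only countably many
  cylinders, so every open set is a countable union of finite intersections of coordinate conditions.
\<close>

lemma measurable_config_borel_coordinatewise: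
  fixes f :: "'b \<Rightarrow> (int ^ 'd \<Rightarrow> 'a::finite)"
  assumes coord: "\<And>l a. {t \<in> space M. f t l = a} \<in> sets M"
  shows "f \<in> measurable M config_borel"
  unfolding config_borel_def
proof (rule measurable_sigma_sets)
  show "sets (sigma UNIV {U :: (int ^ 'd \<Rightarrow> 'a) set. openin config_topology U}) =
      sigma_sets UNIV {U. openin config_topology U}"
    by (simp add: sets_measure_of_conv)
  show "{U :: (int ^ 'd \<Rightarrow> 'a) set. openin config_topology U} \<subseteq> Pow UNIV" by simp
  show "f \<in> space M \<rightarrow> UNIV" by simp
  fix U :: "(int ^ 'd \<Rightarrow> 'a) set" assume "U \<in> {U. openin config_topology U}"
  then have U: "\<forall>x\<in>U. \<exists>F. finite F \<and> cylinder x F \<subseteq> U" by (simp add: openin_config_topology_iff)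
  let ?C = "{cylinder x F | x F. finite F \<and> cylinder x F \<subseteq> U}"
  have "U = \<Union>?C"
  proof (intro equalityI subsetI)
    fix x assume "x \<in> U"
    then obtain F where "finite F" "cylinder x F \<subseteq> U" using U by blast
    then show "x \<in> \<Union>?C" by (intro UnionI[of "cylinder x F"]) (auto simp: cylinder_def)
  qed blast
  then have "f -` U \<inter> space M = f -` (\<Union>?C) \<inter> space M" by (rule arg_cong)
  also have "\<dots> = (\<Union>S\<in>?C. f -` S \<inter> space M)"
    by (simp only: vimage_Union UN_simps(4))
  also have "\<dots> \<in> sets M"
  proof (rule sets.countable_UN'')
    show "countable ?C" by (rule countable_subset[OF _ countable_cylinders]) auto
    fix S assume "S \<in> ?C"
    then obtain x F where S: "S = cylinder x F" and F: "finite F" by blast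
    have "f -` S \<inter> space M = {t \<in> space M. \<forall>l\<in>F. f t l = x l}"
      by (auto simp: S cylinder_def)
    also have "\<dots> \<in> sets M"
      by (rule sets.sets_Collect_finite_All[OF _ F]) (use coord in auto)
    finally show "f -` S \<inter> space M \<in> sets M" .
  qed
  finally show "f -` U \<inter> space M \<in> sets M" .
qed

definition block_map :: "(int ^ 'd) set \<Rightarrow> ((int ^ 'd \<Rightarrow> 'a) \<Rightarrow> 'a) \<Rightarrow> (int ^ 'd \<Rightarrow> 'a) \<Rightarrow> (int ^ 'd \<Rightarrow> 'a)" where
  "block_map B \<phi> a l = \<phi> (\<lambda>b\<in>B. a (l + b))"

text \<open>
  Enlarging the neighbourhood by the origin, with a rule that ignores the new entry, does not change
  the automaton. The origin is needed for the equality of coding domains in \<open>coding_domain_induced\<close>.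
\<close>

lemma cellular_automaton_block_map:
  fixes \<Phi> :: "(int ^ 'd \<Rightarrow> 'a) \<Rightarrow> (int ^ 'd \<Rightarrow> 'a)"
  assumes "cellular_automaton \<Phi>"
  obtains B \<phi> where "finite B" "0 \<in> B" "\<Phi> = block_map B \<phi>"
proof -
  obtain B \<phi> where B: "finite B" and \<Phi>: "\<And>a l. \<Phi> a l = \<phi> (\<lambda>b\<in>B. a (l + b))"
    using assms unfolding cellular_automaton_def by blast
  have "restrict (\<lambda>b\<in>insert 0 B. a (l + b)) B = (\<lambda>b\<in>B. a (l + b))" for a :: "int ^ 'd \<Rightarrow> 'a" and l
    by (auto simp: restrict_def)
  then have "\<Phi> = block_map (insert 0 B) (\<lambda>p. \<phi> (restrict p B))"
    by (intro ext) (simp only: \<Phi> block_map_def)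
  with B show ?thesis by (intro that[of "insert 0 B"]) auto
qed

lemma continuous_map_block_map:
  fixes \<phi> :: "(int ^ 'd \<Rightarrow> 'a) \<Rightarrow> 'a"
  assumes "finite B"
  shows "continuous_map config_topology config_topology (block_map B \<phi>)"
  unfolding continuous_map_def
proof (intro conjI allI impI)
  fix U :: "(int ^ 'd \<Rightarrow> 'a) set" assume U: "openin config_topology U"
  have "\<exists>F. finite F \<and> cylinder x F \<subseteq> {a. block_map B \<phi> a \<in> U}" if x: "block_map B \<phi> x \<in> U" for x
  proof -
    obtain F where F: "finite F" "cylinder (block_map B \<phi> x) F \<subseteq> U"
      using U x unfolding openin_config_topology_iff by blast
    \<comment> \<open>The sites that influence the image on \<open>F\<close>.\<close>
    let ?G = "(\<lambda>(l, b). l + b) ` (F \<times> B)"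
    have "block_map B \<phi> a \<in> cylinder (block_map B \<phi> x) F" if "a \<in> cylinder x ?G" for a
    proof -
      have "(\<lambda>b\<in>B. a (l + b)) = (\<lambda>b\<in>B. x (l + b))" if "l \<in> F" for l
        using \<open>a \<in> cylinder x ?G\<close> that by (intro restrict_ext) (auto simp: cylinder_def)
      then show ?thesis by (simp add: cylinder_def block_map_def)
    qed
    then show ?thesis using F assms by (intro exI[of _ ?G]) auto
  qed
  then show "openin config_topology {a \<in> topspace config_topology. block_map B \<phi> a \<in> U}"
    by (simp add: openin_config_topology_iff)
qed simp

text \<open>
  Continuity gives one inclusion. For the other, a continuous map from a compact to a Hausdorff space
  is closed; compactness comes from Tychonoff and the finiteness of the alphabet.
\<close>

lemma block_map_image_closure_of:
  fixes \<phi> :: "(int ^ 'd \<Rightarrow> 'a::finite) \<Rightarrow> 'a"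
  assumes "finite B"
  shows "block_map B \<phi> ` (config_topology closure_of S) = config_topology closure_of (block_map B \<phi> ` S)"
proof
  let ?X = "config_topology :: (int ^ 'd \<Rightarrow> 'a) topology"
  have cont: "continuous_map ?X ?X (block_map B \<phi>)"
    using assms by (rule continuous_map_block_map)
  show "block_map B \<phi> ` (?X closure_of S) \<subseteq> ?X closure_of (block_map B \<phi> ` S)"
    by (rule continuous_map_image_closure_subset[OF cont])
  have "compact_space ?X"
    by (simp add: config_topology_def compact_space_product_topology compact_space_discrete_topology)
  moreover have "Hausdorff_space ?X"
    by (simp add: config_topology_def Hausdorff_space_product_topology)
  ultimately have "closed_map ?X ?X (block_map B \<phi>)"
    by (rule continuous_imp_closed_map[OF cont])
  then show "?X closure_of (block_map B \<phi> ` S) \<subseteq> block_map B \<phi> ` (?X closure_of S)"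
    by (simp add: closed_map_closure_of_image)
qed

lemma measurable_block_map:
  fixes \<phi> :: "(int ^ 'd \<Rightarrow> 'a::finite) \<Rightarrow> 'a"
  assumes "finite B"
  shows "block_map B \<phi> \<in> measurable config_borel config_borel"
proof (rule measurable_config_borel_coordinatewise)
  fix l :: "int ^ 'd" and a :: 'a
  have "openin config_topology {x. block_map B \<phi> x \<in> cylinder (\<lambda>_. a) {l}}"
    using openin_continuous_map_preimage[OF continuous_map_block_map[OF assms, of \<phi>] openin_cylinder[of "{l}"]]
    by simp
  then have "openin config_topology {x. block_map B \<phi> x l = a}" by (simp add: cylinder_def)
  then show "{x \<in> space config_borel. block_map B \<phi> x l = a} \<in> sets config_borel"
    by (simp add: config_borel_def sets_measure_of_conv space_measure_of_conv)
qed

section \<open>Codings and the pulled-back partition\<close>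

lemma coding_eqI:
  assumes "disjoint_family P" "t + \<tau> l \<in> P a"
  shows "coding \<tau> P t l = a"
  unfolding coding_def rotation_def
  using assms by (intro the_equality) (auto simp: disjoint_family_on_def)

text \<open>
  On \<open>D\<close> a coordinate of the coding takes a given value exactly on a translated atom, and translated
  atoms are Lebesgue measurable.
\<close>

lemma measurable_coding:
  fixes P :: "'a::finite \<Rightarrow> (circle ^ 'k) set"
  assumes P: "measurable_partition P" and dom: "\<And>t l. t \<in> D \<Longrightarrow> t + \<tau> l \<in> (\<Union>a. P a)"
  shows "coding \<tau> P \<in> measurable (restrict_space torus_measure D) config_borel"
proof (rule measurable_config_borel_coordinatewise)
  fix l and a :: 'a
  have disj: "disjoint_family P" using P by (simp add: measurable_partition_def)
  have "coding \<tau> P t l = a \<longleftrightarrow> t + \<tau> l \<in> P a" if "t \<in> D" for t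
    using dom[OF that, of l] coding_eqI[where P = P and t = t and \<tau> = \<tau> and l = l, OF disj] by blast
  then have "{t \<in> space (restrict_space torus_measure D). coding \<tau> P t l = a}
      = D \<inter> (\<lambda>t. t + \<tau> l) -` P a"
    by (auto simp: space_restrict_space)
  moreover have "(\<lambda>t. t + \<tau> l) -` P a \<in> sets torus_measure"
    using measurable_sets[OF measurable_torus_translation, of "P a"] P
    by (simp add: measurable_partition_def)
  ultimately show "{t \<in> space (restrict_space torus_measure D). coding \<tau> P t l = a}
      \<in> sets (restrict_space torus_measure D)"
    by (auto simp: sets_restrict_space)
qed

text \<open>
  The point \<open>t\<close> is classified by what the local rule reads at the origin of its coding. Membership of
  all \<open>t + \<tau> b\<close> in the union of the atoms is required because \<open>coding\<close> is arbitrary elsewhere.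
\<close>

definition induced_partition ::
    "(int ^ 'd \<Rightarrow> circle ^ 'k) \<Rightarrow> (int ^ 'd) set \<Rightarrow> ((int ^ 'd \<Rightarrow> 'a) \<Rightarrow> 'a)
      \<Rightarrow> ('a \<Rightarrow> (circle ^ 'k) set) \<Rightarrow> 'a \<Rightarrow> (circle ^ 'k) set" where
  "induced_partition \<tau> B \<phi> P c =
     {t. (\<forall>b\<in>B. t + \<tau> b \<in> (\<Union>a. P a)) \<and> \<phi> (\<lambda>b\<in>B. coding \<tau> P t b) = c}"

lemma disjoint_induced_partition: "disjoint_family (induced_partition \<tau> B \<phi> P)"
  by (auto simp: disjoint_family_on_def induced_partition_def)

lemma UN_induced_partition:
  "(\<Union>c. induced_partition \<tau> B \<phi> P c) = (\<Inter>b\<in>B. (\<lambda>t. t + \<tau> b) -` (\<Union>a. P a))"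
  by (auto simp: induced_partition_def)

text \<open>
  Splitting by the neighbourhood pattern exhibits the atoms as finite Boolean combinations, without
  complements, of translated atoms of \<open>P\<close>. This is what transports measurability and openness.
\<close>

lemma induced_partition_eq_UN_patterns:
  assumes disj: "disjoint_family P"
  shows "induced_partition \<tau> B \<phi> P c =
    (\<Union>p\<in>{p \<in> B \<rightarrow>\<^sub>E UNIV. \<phi> p = c}. \<Inter>b\<in>B. (\<lambda>t. t + \<tau> b) -` P (p b))" (is "_ = ?R")
proof (intro equalityI subsetI)
  fix t assume t: "t \<in> induced_partition \<tau> B \<phi> P c"
  let ?p = "\<lambda>b\<in>B. coding \<tau> P t b"
  have "t + \<tau> b \<in> P (?p b)" if b: "b \<in> B" for b
  proof -
    obtain a where a: "t + \<tau> b \<in> P a"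
      using t b by (auto simp: induced_partition_def)
    then show ?thesis using coding_eqI[of P t \<tau> b a, OF disj a] b by simp
  qed
  moreover have "\<phi> ?p = c" using t by (simp add: induced_partition_def)
  ultimately show "t \<in> ?R" by (intro UN_I[of ?p]) auto
next
  fix t assume "t \<in> ?R"
  then obtain p where p: "p \<in> B \<rightarrow>\<^sub>E UNIV" "\<phi> p = c" and t: "\<And>b. b \<in> B \<Longrightarrow> t + \<tau> b \<in> P (p b)"
    by auto
  have "(\<lambda>b\<in>B. coding \<tau> P t b) = p"
    using p(1) coding_eqI[of P t \<tau> b "p b" for b, OF disj t] by (intro ext) (auto simp: PiE_def extensional_def)
  then show "t \<in> induced_partition \<tau> B \<phi> P c"
    using p t by (auto simp: induced_partition_def)
qed

lemma measurable_partition_induced: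
  fixes P :: "'a::finite \<Rightarrow> (circle ^ 'k) set"
  assumes P: "measurable_partition P" and B: "finite B" "B \<noteq> {}"
  shows "measurable_partition (induced_partition \<tau> B \<phi> P)"
proof -
  have disj: "disjoint_family P" and meas: "\<And>a. P a \<in> sets torus_measure"
    and one: "emeasure torus_measure (\<Union>a. P a) = 1"
    using P by (auto simp: measurable_partition_def)
  have pre: "(\<lambda>t. t + s) -` A \<in> sets torus_measure" if "A \<in> sets torus_measure"
    for A :: "(circle ^ 'k) set" and s
    using measurable_sets[OF measurable_torus_translation that] by simp
  have "finite (B \<rightarrow>\<^sub>E (UNIV :: 'a set))" using B by (intro finite_PiE) auto
  then have sets: "induced_partition \<tau> B \<phi> P c \<in> sets torus_measure" for c
    unfolding induced_partition_eq_UN_patterns[OF disj]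
    using B by (intro sets.finite_UN sets.finite_INT pre meas) auto
  have "AE t in torus_measure. \<forall>b\<in>B. t + \<tau> b \<in> (\<Union>a. P a)"
    by (intro AE_finite_allI B AE_torus_translation one sets.finite_UN meas) auto
  then have "AE t in torus_measure. t \<in> (\<Union>c. induced_partition \<tau> B \<phi> P c)"
    unfolding UN_induced_partition by simp
  moreover have "(\<Union>c. induced_partition \<tau> B \<phi> P c) \<in> sets torus_measure"
    by (intro sets.finite_UN sets) auto
  ultimately have "emeasure torus_measure (\<Union>c. induced_partition \<tau> B \<phi> P c) = 1"
    by (intro prob_space.emeasure_eq_1_AE[OF prob_space_torus_measure])
  then show ?thesis
    by (simp add: measurable_partition_def sets disjoint_induced_partition)
qed

lemma open_partition_induced:
  fixes P :: "'a::finite \<Rightarrow> (circle ^ 'k) set"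
  assumes P: "open_partition P" and B: "finite B" "B \<noteq> {}"
  shows "open_partition (induced_partition \<tau> B \<phi> P)"
proof -
  have disj: "disjoint_family P" and mp: "measurable_partition P" and op: "\<And>a. open (P a)"
    and dense: "closure (\<Union>a. P a) = UNIV"
    using P by (auto simp: open_partition_def measurable_partition_def)
  have pre: "open ((\<lambda>t. t + s) -` A)" if "open A" for A :: "(circle ^ 'k) set" and s
    using that continuous_torus_translation by (rule open_vimage)
  have "open (induced_partition \<tau> B \<phi> P c)" for c
    unfolding induced_partition_eq_UN_patterns[OF disj] using B op pre by blast
  moreover have "closure (\<Union>c. induced_partition \<tau> B \<phi> P c) = UNIV"
    unfolding UN_induced_partition
    by (intro closure_INT_open_dense B pre closure_translation_preimage dense open_UN ballI op)
  ultimately show ?thesis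
    using measurable_partition_induced[OF mp B] by (simp add: open_partition_def)
qed

context
  fixes \<tau> :: "int ^ 'd \<Rightarrow> circle ^ 'k"
  assumes hom: "\<And>x y. \<tau> (x + y) = \<tau> x + \<tau> y"
begin

text \<open>
  As the sites form a group, intersecting the forward images of the union of the atoms over all sites is the
  same as asking that the whole orbit stay in that union.
\<close>

lemma coding_domain_iff: "t \<in> coding_domain \<tau> P \<longleftrightarrow> (\<forall>l. t + \<tau> l \<in> (\<Union>a. P a))"
proof -
  have "\<tau> 0 = 0" using hom[of 0 0] by simp
  then have neg: "\<tau> (- l) = - \<tau> l" for l
    using hom[of l "- l"] by (simp add: eq_neg_iff_add_eq_0 add.commute)
  have "t \<in> rotation \<tau> l ` A \<longleftrightarrow> t + \<tau> (- l) \<in> A" for l A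
    by (force simp: rotation_def neg image_iff)
  then have "t \<in> coding_domain \<tau> P \<longleftrightarrow> (\<forall>l. t + \<tau> (- l) \<in> (\<Union>a. P a))"
    unfolding coding_domain_def by blast
  then show ?thesis by (metis minus_minus)
qed

lemma coding_translate: "coding \<tau> P (t + \<tau> l) b = coding \<tau> P t (l + b)"
  by (simp add: coding_def rotation_def hom add.assoc)

text \<open>
  Asking that every \<open>B\<close>-neighbourhood of the orbit lie in the union of the atoms asks nothing
  new of the orbit; and since \<open>B\<close> contains the origin it asks no less.
\<close>

lemma coding_domain_induced:
  assumes "0 \<in> B"
  shows "coding_domain \<tau> (induced_partition \<tau> B \<phi> P) = coding_domain \<tau> P"
proof -
  have shift: "t + \<tau> l + \<tau> b = t + \<tau> (l + b)" for t l b
    by (simp add: hom add.assoc)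
  have "(\<forall>l. \<forall>b\<in>B. t + \<tau> l + \<tau> b \<in> A) \<longleftrightarrow> (\<forall>l. t + \<tau> l \<in> A)" for t A
    unfolding shift using assms by (metis add.right_neutral)
  then show ?thesis
    by (simp only: set_eq_iff coding_domain_iff UN_induced_partition INT_iff vimage_eq simp_thms)
qed

text \<open>
  The coding of \<open>t + \<tau> l\<close> is the coding of \<open>t\<close> shifted by \<open>l\<close>, so what the rule reads at
  the origin for \<open>t + \<tau> l\<close> is what it reads at \<open>l\<close> for \<open>t\<close>.
\<close>

lemma coding_induced:
  assumes "t \<in> coding_domain \<tau> P"
  shows "coding \<tau> (induced_partition \<tau> B \<phi> P) t = block_map B \<phi> (coding \<tau> P t)"
proof
  fix l
  have "t + \<tau> l + \<tau> b \<in> (\<Union>a. P a)" for b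
    using assms[unfolded coding_domain_iff, rule_format, of "l + b"] by (simp add: hom add.assoc)
  then have "t + \<tau> l \<in> induced_partition \<tau> B \<phi> P (block_map B \<phi> (coding \<tau> P t) l)"
    by (simp add: induced_partition_def block_map_def coding_translate cong: restrict_cong)
  then show "coding \<tau> (induced_partition \<tau> B \<phi> P) t l = block_map B \<phi> (coding \<tau> P t) l"
    by (rule coding_eqI[OF disjoint_induced_partition])
qed

end

theorem theorem3p1:
  fixes \<tau> :: "int ^ 'd \<Rightarrow> circle ^ 'k"
    and \<Phi> :: "(int ^ 'd \<Rightarrow> 'a::finite) \<Rightarrow> (int ^ 'd \<Rightarrow> 'a)"
  assumes "\<And>x y. \<tau> (x + y) = \<tau> x + \<tau> y"
    and "inj \<tau>"
    and "closure (range \<tau>) = UNIV"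
    and "cellular_automaton \<Phi>"
  shows "(\<forall>p \<in> quasisturmian_sequences \<tau>. \<Phi> p \<in> quasisturmian_sequences \<tau>)
       \<and> (\<forall>X. quasisturmian_shift \<tau> X \<longrightarrow> quasisturmian_shift \<tau> (\<Phi> ` X))
       \<and> (\<forall>\<mu>. quasisturmian_measure \<tau> \<mu> \<longrightarrow> quasisturmian_measure \<tau> (distr \<mu> config_borel \<Phi>))"
proof -
  obtain B \<phi> where B: "finite B" "0 \<in> B" and \<Phi>: "\<Phi> = block_map B \<phi>"
    using cellular_automaton_block_map[OF assms(4)] by blast
  then have "B \<noteq> {}" by blast
  define Q where "Q P = induced_partition \<tau> B \<phi> P" for P :: "'a \<Rightarrow> (circle ^ 'k) set"
  have dom: "coding_domain \<tau> (Q P) = coding_domain \<tau> P" for P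
    unfolding Q_def using assms(1) B(2) by (rule coding_domain_induced)
  have cod: "coding \<tau> (Q P) t = \<Phi> (coding \<tau> P t)" if "t \<in> coding_domain \<tau> P" for P t
    unfolding Q_def \<Phi> using assms(1) that by (rule coding_induced)
  have op: "open_partition (Q P)" if "open_partition P" for P
    unfolding Q_def using that B(1) \<open>B \<noteq> {}\<close> by (rule open_partition_induced)
  show ?thesis
  proof (intro conjI ballI allI impI)
    fix p :: "int ^ 'd \<Rightarrow> 'a" assume "p \<in> quasisturmian_sequences \<tau>"
    then obtain P t where P: "open_partition P" and t: "t \<in> coding_domain \<tau> P" and p: "p = coding \<tau> P t"
      unfolding quasisturmian_sequences_def by blast
    have "\<Phi> p = coding \<tau> (Q P) t" using cod[OF t] p by simp
    then show "\<Phi> p \<in> quasisturmian_sequences \<tau>"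
      unfolding quasisturmian_sequences_def using op[OF P] t dom[of P] by blast
  next
    fix X :: "(int ^ 'd \<Rightarrow> 'a) set" assume "quasisturmian_shift \<tau> X"
    then obtain P where P: "open_partition P"
      and X: "X = config_topology closure_of (coding \<tau> P ` coding_domain \<tau> P)"
      unfolding quasisturmian_shift_def by blast
    have "\<Phi> ` X = config_topology closure_of (\<Phi> ` coding \<tau> P ` coding_domain \<tau> P)"
      unfolding X \<Phi> by (rule block_map_image_closure_of[OF B(1)])
    also have "\<Phi> ` coding \<tau> P ` coding_domain \<tau> P = coding \<tau> (Q P) ` coding_domain \<tau> (Q P)"
      using cod by (force simp: dom image_image)
    finally show "quasisturmian_shift \<tau> (\<Phi> ` X)"
      unfolding quasisturmian_shift_def using op[OF P] by blast
  next
    fix \<mu> :: "(int ^ 'd \<Rightarrow> 'a) measure" assume "quasisturmian_measure \<tau> \<mu>"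
    then obtain P where P: "measurable_partition P"
      and \<mu>: "\<mu> = distr (restrict_space torus_measure (coding_domain \<tau> P)) config_borel (coding \<tau> P)"
      unfolding quasisturmian_measure_def by blast
    let ?R = "restrict_space torus_measure (coding_domain \<tau> P)"
    have "coding \<tau> P \<in> measurable ?R config_borel"
      using P by (rule measurable_coding) (use coding_domain_iff[OF assms(1)] in blast)
    moreover have "\<Phi> \<in> measurable config_borel config_borel"
      unfolding \<Phi> using B(1) by (rule measurable_block_map)
    ultimately have "distr \<mu> config_borel \<Phi> = distr ?R config_borel (\<Phi> \<circ> coding \<tau> P)"
      unfolding \<mu> by (intro distr_distr)
    also have "\<dots> = distr ?R config_borel (coding \<tau> (Q P))"
      by (intro distr_cong) (auto simp: space_restrict_space cod)
    finally show "quasisturmian_measure \<tau> (distr \<mu> config_borel \<Phi>)"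
      unfolding quasisturmian_measure_def
      using measurable_partition_induced[OF P B(1) \<open>B \<noteq> {}\<close>] dom[of P] Q_def by metis
  qed
qed

end
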